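(* Let $p$ be a prime and $m=2(p^2+p+1)$. Then there exists a subset $A\subseteq \mathbb{Z}_m$ such that $R_A(n)\le 5$ for all $n\in\mathbb{Z}_m$ and $$|\{n\in\mathbb{Z}_m:\ R_A(n)=0\}|<\frac{3}{8}m.$$
   Context: $\mathbb{Z}_m$ is the additive group of residue classes modulo $m$. For $A\subseteq\mathbb{Z}_m$ and $n\in\mathbb{Z}_m$, $R_A(n)$ denotes the number of ordered pairs $(a,a')\in A\times A$ with $a+a'=n$. *)

theory Defs
  imports Complex_Main "HOL-Computational_Algebra.Primes" "HOL-Algebra.Elementary_Groups"
begin

text \<open>The group operation of \<open>integer_mod_group m\<close> is addition modulo \<open>m\<close>,
  written multiplicatively, on the representatives \<open>0, \<dots>, m - 1\<close>.\<close>

definition rep_count :: "('a, 'b) monoid_scheme \<Rightarrow> 'a set \<Rightarrow> 'a \<Rightarrow> nat" where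
  "rep_count G A n = card {(a, a'). a \<in> A \<and> a' \<in> A \<and> a \<otimes>\<^bsub>G\<^esub> a' = n}"

end

theory Submission
  imports Defs "HOL-Algebra.Polynomial_Divisibility" "HOL-Algebra.Multiplicative_Group"
    "HOL-Number_Theory.Residues"
begin

text \<open>
  Let \<open>N = p\<^sup>2 + p + 1\<close>. Singer's theorem provides a Sidon set \<open>D\<close> of size \<open>p + 1\<close> modulo \<open>N\<close>:
  in the cubic extension of the field with \<open>p\<close> elements, generated by \<open>\<theta>\<close>, take the discrete
  logarithms of \<open>1\<close> and of all \<open>\<theta> + b\<close>; modulo \<open>N\<close> these only see field elements up to
  scalars of the base field. For odd \<open>u\<close> put \<open>A = 2D \<union> (2D + u)\<close> modulo \<open>2N\<close>. The parity of a sum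
  determines whether its two terms come from the same layer, so every sum has at most four
  representations. If \<open>C\<close> is the complement of \<open>D + D\<close> modulo \<open>N\<close>, the sums missed by \<open>A\<close> are
  the odd \<open>2s + u\<close> with \<open>s \<in> C\<close> and the even \<open>2s\<close> with \<open>s \<in> C \<inter> (C + u)\<close>. Averaging over \<open>u\<close>
  yields at most \<open>|C| + |C|\<^sup>2 / N\<close> of them for some \<open>u\<close>, and \<open>|C| = p (p - 1) / 2 < N / 2\<close>.
\<close>

section \<open>Sidon sets and doubled Sidon sets\<close>

text \<open>Equality of the sets \<open>{a, b}\<close> and \<open>{c, d}\<close> is equality up to
  order, with \<open>a = b\<close> allowed. \<open>D\<close> consists of integers rather than
  reduced residues; the case \<open>b = d\<close> makes congruent elements equal.\<close>

definition sidon_mod :: "int \<Rightarrow> int set \<Rightarrow> bool" where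
  "sidon_mod N D \<longleftrightarrow> (\<forall>a\<in>D. \<forall>b\<in>D. \<forall>c\<in>D. \<forall>d\<in>D. [a + b = c + d] (mod N) \<longrightarrow> {a, b} = {c, d})"

lemma sidon_modD:
  "sidon_mod N D \<Longrightarrow> a \<in> D \<Longrightarrow> b \<in> D \<Longrightarrow> c \<in> D \<Longrightarrow> d \<in> D \<Longrightarrow> [a + b = c + d] (mod N) \<Longrightarrow>
    a = c \<and> b = d \<or> a = d \<and> b = c"
  unfolding sidon_mod_def by (metis doubleton_eq_iff)

definition sumset_mod :: "int \<Rightarrow> int set \<Rightarrow> int set" where
  "sumset_mod N D = (\<lambda>(a, b). (a + b) mod N) ` (D \<times> D)"

text \<open>Distinct unordered pairs, repetition allowed, have distinct sums, and \<open>k\<close>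
  elements form \<open>k + (k choose 2)\<close> such pairs.\<close>

lemma card_sumset_sidon:
  assumes "finite D" "sidon_mod N D"
  shows "Suc (card D) choose 2 \<le> card (sumset_mod N D)"
proof -
  define F where "F k = {S. S \<subseteq> D \<and> card S = k}" for k
  have "card (F 1 \<union> F 2) = card (F 1) + card (F 2)"
    using assms(1) by (intro card_Un_disjoint) (auto simp: F_def)
  also have "\<dots> = (card D choose 1) + (card D choose 2)"
    unfolding F_def by (simp only: n_subsets[OF assms(1)])
  also have "\<dots> = Suc (card D) choose 2"
    by (simp add: numeral_2_eq_2)
  finally have card: "card (F 1 \<union> F 2) = Suc (card D) choose 2" .
  \<comment> \<open>\<open>Min\<close> and \<open>Max\<close> recover the two summands from the set,
    and yield the pair \<open>a, a\<close> on a singleton.\<close>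
  have Min_Max: "S = {Min S, Max S} \<and> Min S \<in> D \<and> Max S \<in> D" if "S \<in> F 1 \<union> F 2" for S
  proof -
    from that consider (one) a where "S = {a}" | (two) a b where "S = {a, b}"
      by (auto simp: F_def card_1_singleton_iff card_2_iff)
    moreover have "S \<subseteq> D" using that by (auto simp: F_def)
    ultimately show ?thesis by cases (auto simp: min_def max_def)
  qed
  \<comment> \<open>Unordered pairs, repetition allowed, are the subsets of size one and two.\<close>
  have "inj_on (\<lambda>S. (Min S + Max S) mod N) (F 1 \<union> F 2)"
  proof (rule inj_onI)
    fix S S' assume S: "S \<in> F 1 \<union> F 2" and S': "S' \<in> F 1 \<union> F 2"
      and "(Min S + Max S) mod N = (Min S' + Max S') mod N"
    then have "{Min S, Max S} = {Min S', Max S'}"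
      using assms(2) Min_Max[OF S] Min_Max[OF S'] unfolding sidon_mod_def cong_def by blast
    then show "S = S'"
      using Min_Max[OF S] Min_Max[OF S'] by simp
  qed
  then have "card (F 1 \<union> F 2) = card ((\<lambda>S. (Min S + Max S) mod N) ` (F 1 \<union> F 2))"
    by (simp add: card_image)
  also have "\<dots> \<le> card (sumset_mod N D)"
    using Min_Max assms(1) by (intro card_mono) (fastforce simp: sumset_mod_def)+
  finally show ?thesis using card by simp
qed

text \<open>Double counting: every pair in \<open>C \<times> C\<close> belongs to exactly one shift
  \<open>v\<close>, so the \<open>N\<close> intersections have total size \<open>card C ^ 2\<close>,
  and some intersection is at most the average.\<close>

lemma exists_small_translate_intersection:
  fixes N :: int
  assumes "N > 0" "C \<subseteq> {0..<N}"
  shows "\<exists>v\<in>{0..<N}. N * int (card {s \<in> C. (s - v) mod N \<in> C}) \<le> int (card C) ^ 2"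
proof (rule ccontr)
  assume neg: "\<not> ?thesis"
  have fin: "finite C" using assms(2) finite_subset by blast
  have translates: "card {v \<in> {0..<N}. (s - v) mod N \<in> C} = card C" for s
  \<comment> \<open>For fixed \<open>s\<close>, subtraction from \<open>s\<close> modulo
    \<open>N\<close> is its own inverse on residues and exchanges the counted shifts with
    \<open>C\<close>.\<close>
  proof (rule bij_betw_same_card, rule bij_betw_byWitness[where f' = "\<lambda>c. (s - c) mod N"])
    have "(s - (s - x) mod N) mod N = x" if "x \<in> {0..<N}" for x
      using that by (simp add: mod_diff_right_eq)
    then show "\<forall>v\<in>{v \<in> {0..<N}. (s - v) mod N \<in> C}. (s - (s - v) mod N) mod N = v"
      "\<forall>c\<in>C. (s - (s - c) mod N) mod N = c"
      "(\<lambda>c. (s - c) mod N) ` C \<subseteq> {v \<in> {0..<N}. (s - v) mod N \<in> C}"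
      using assms by auto
  qed auto
  have "(\<Sum>v\<in>{0..<N}. card {s \<in> C. (s - v) mod N \<in> C}) = (\<Sum>s\<in>C. card {v \<in> {0..<N}. (s - v) mod N \<in> C})"
    by (rule sum_multicount_gen) (use fin in auto)
  also have "\<dots> = card C ^ 2"
    using translates by (simp add: power2_eq_square)
  finally have "(\<Sum>v\<in>{0..<N}. int (card {s \<in> C. (s - v) mod N \<in> C})) = int (card C) ^ 2"
    by (simp flip: of_nat_sum)
  then have "(\<Sum>v\<in>{0..<N}. N * int (card {s \<in> C. (s - v) mod N \<in> C})) = N * int (card C) ^ 2"
    by (simp flip: sum_distrib_left)
  moreover have "(\<Sum>v\<in>{0..<N}. int (card C) ^ 2) < (\<Sum>v\<in>{0..<N}. N * int (card {s \<in> C. (s - v) mod N \<in> C}))"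
    by (rule sum_strict_mono) (use neg assms(1) in \<open>auto simp: not_le\<close>)
  ultimately show False using assms(1) by simp
qed

section \<open>Two-layer sets modulo \<open>2 * N\<close>\<close>

lemma cong_double_iff: "[2 * x = 2 * y] (mod 2 * N) \<longleftrightarrow> [x = y] (mod N)" for x y N :: int
  by (simp add: cong_def)

text \<open>Doubling identifies residues modulo \<open>N\<close> with even residues modulo
  \<open>2 * N\<close>. The index \<open>e\<close> is the layer; for odd \<open>u\<close> it is the
  parity of the element.\<close>

definition two_layers :: "int \<Rightarrow> int \<Rightarrow> int set \<Rightarrow> int set" where
  "two_layers N u D = (\<lambda>(d, e). (2 * d + e * u) mod (2 * N)) ` (D \<times> {0, 1})"

context
  fixes N :: nat and u :: int and D :: "int set"
  assumes N: "N > 0" and u: "odd u"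
begin

lemma two_layers_subset: "two_layers N u D \<subseteq> {0..<2 * int N}"
  using N by (auto simp: two_layers_def)

text \<open>Once the layer of the first summand is fixed, the parity of \<open>n\<close> fixes the
  layer of the second. What remains is a sum modulo \<open>N\<close>, which the Sidon property
  determines up to order; two orders and two layers give four.\<close>

lemma rep_count_two_layers_le:
  assumes sidon: "sidon_mod N D"
  shows "rep_count (integer_mod_group (2 * N)) (two_layers N u D) n \<le> 4"
proof -
  define A where "A = two_layers N u D"
  define f where "f d e = (2 * d + e * u) mod (2 * int N)" for d e
  define T where "T e = {(a, b). (\<exists>d\<in>D. a = f d e) \<and> b \<in> A \<and> (a + b) mod (2 * int N) = n}" for e
  have A_eq: "A = (\<lambda>(d, e). f d e) ` (D \<times> {0, 1})"
    by (simp add: A_def two_layers_def f_def)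
  have bound: "finite (T e) \<and> card (T e) \<le> 2" for e
  proof (cases "T e = {}")
    case False
    \<comment> \<open>Reduction modulo the even number \<open>2 * N\<close> keeps parity, and
      \<open>u\<close> is odd, so a sum reveals the parity of \<open>e + e'\<close>.\<close>
    have parity: "even ((2 * d + e * u + (2 * d' + e' * u)) mod (2 * int N)) \<longleftrightarrow> even (e + e')" for d d' e e'
      using u by (auto simp: dvd_mod_iff)
    have T_elem: "\<exists>d\<in>D. \<exists>d'\<in>D. \<exists>e'\<in>{0, 1}. x = (f d e, f d' e') \<and>
      (2 * d + e * u + (2 * d' + e' * u)) mod (2 * int N) = n" if x: "x \<in> T e" for x
    proof -
      obtain d b where d: "d \<in> D" "x = (f d e, b)" "b \<in> A" "(f d e + b) mod (2 * int N) = n"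
        using x by (auto simp: T_def)
      moreover obtain d' e' where d': "d' \<in> D" "e' \<in> {0, 1}" "b = f d' e'"
        using d(3) unfolding A_eq by (elim imageE SigmaE) simp
      moreover have "(f d e + f d' e') mod (2 * int N) = (2 * d + e * u + (2 * d' + e' * u)) mod (2 * int N)"
        by (simp only: f_def mod_add_eq)
      ultimately show ?thesis by (intro bexI[of _ d] bexI[of _ d'] bexI[of _ e']) simp_all
    qed
    obtain d d' e' where d: "d \<in> D" "d' \<in> D" "e' \<in> {0, 1}"
      and n: "(2 * d + e * u + (2 * d' + e' * u)) mod (2 * int N) = n"
      using False T_elem by (metis ex_in_conv)
    \<comment> \<open>With one representation fixed, another can only exchange \<open>d\<close> and
      \<open>d'\<close>, while the layers stay in place.\<close>
    have "T e \<subseteq> {(f d e, f d' e'), (f d' e, f d e')}"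
    proof
      fix x assume "x \<in> T e"
      then obtain c c' i where x: "x = (f c e, f c' i)" and c: "c \<in> D" "c' \<in> D" "i \<in> {0, 1}"
        and n': "(2 * c + e * u + (2 * c' + i * u)) mod (2 * int N) = n"
        using T_elem by metis
      have "even (e + i) \<longleftrightarrow> even (e + e')"
        using parity n n' by metis
      with d c have "i = e'" by auto
      have "[2 * c + e * u + (2 * c' + e' * u) = 2 * d + e * u + (2 * d' + e' * u)] (mod 2 * int N)"
        using n n' \<open>i = e'\<close> by (simp add: cong_def)
      then have "[2 * (c + c') = 2 * (d + d')] (mod 2 * int N)"
        by (simp add: cong_iff_dvd_diff algebra_simps)
      then have "[c + c' = d + d'] (mod int N)"
        by (simp only: cong_double_iff)
      then have "c = d \<and> c' = d' \<or> c = d' \<and> c' = d"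
        using sidon_modD[OF sidon] c d by blast
      then show "x \<in> {(f d e, f d' e'), (f d' e, f d e')}"
        using x \<open>i = e'\<close> by auto
    qed
    then show ?thesis
      using card_mono[of "{(f d e, f d' e'), (f d' e, f d e')}" "T e"] finite_subset
      by (fastforce simp: card_insert_if split: if_splits)
  qed auto
  have "rep_count (integer_mod_group (2 * N)) A n \<le> card (T 0 \<union> T 1)"
    unfolding rep_count_def
  proof (rule card_mono)
    have "\<exists>d\<in>D. a = f d 0 \<or> a = f d 1" if "a \<in> A" for a
      using that unfolding A_eq by auto
    then show "{(a, a'). a \<in> A \<and> a' \<in> A \<and> a \<otimes>\<^bsub>integer_mod_group (2 * N)\<^esub> a' = n} \<subseteq> T 0 \<union> T 1"
      by (fastforce simp: T_def)
  qed (use bound in simp)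
  also have "\<dots> \<le> card (T 0) + card (T 1)" by (rule card_Un_le)
  also have "\<dots> \<le> 4" using bound[of 0] bound[of 1] by linarith
  finally show ?thesis unfolding A_def .
qed

text \<open>Mixed layers reach \<open>2 * s + u\<close> whenever \<open>s\<close> is a sum from
  \<open>D\<close>. An even \<open>2 * s\<close> can be reached inside either layer, so missing it
  puts both \<open>s\<close> and \<open>s - u\<close> into \<open>C\<close> modulo
  \<open>N\<close>.\<close>

lemma card_non_sums_two_layers_le:
  fixes C :: "int set"
  defines "C \<equiv> {0..<int N} - sumset_mod N D"
  assumes "finite D"
  shows "card {n \<in> {0..<2 * int N}. rep_count (integer_mod_group (2 * N)) (two_layers N u D) n = 0}
    \<le> card C + card {s \<in> C. (s - u) mod N \<in> C}"
proof -
  define A where "A = two_layers N u D"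
  define Z where "Z = {n \<in> {0..<2 * int N}. rep_count (integer_mod_group (2 * N)) A n = 0}"
  have "finite C" by (simp add: C_def)
  have finA: "finite A" using \<open>finite D\<close> by (simp add: A_def two_layers_def)
  have Z: "(a + b) mod (2 * int N) \<noteq> n" if "n \<in> Z" "a \<in> A" "b \<in> A" for n a b
  proof -
    \<comment> \<open>\<open>card\<close> is zero on infinite sets too; finiteness turns a zero
      count into the absence of representations.\<close>
    have "finite {(a, a'). a \<in> A \<and> a' \<in> A \<and> a \<otimes>\<^bsub>integer_mod_group (2 * N)\<^esub> a' = n}"
      by (rule finite_subset[of _ "A \<times> A"]) (use finA in auto)
    then show ?thesis using that by (auto simp: Z_def rep_count_def)
  qed
  have not_sum: "s mod N \<in> C" if "(2 * s + (e + e') * u) mod (2 * int N) \<in> Z" "e \<in> {0, 1}" "e' \<in> {0, 1}" for s e e'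
  proof (rule ccontr)
    assume "s mod N \<notin> C"
    then obtain d d' where d: "d \<in> D" "d' \<in> D" "[s = d + d'] (mod N)"
      using N by (auto simp: C_def sumset_mod_def cong_def)
    then have "[2 * s = 2 * (d + d')] (mod 2 * int N)" by (simp only: cong_double_iff)
    then have "[2 * s + (e + e') * u = 2 * (d + d') + (e + e') * u] (mod 2 * int N)"
      by (rule cong_add) simp
    then have "((2 * d + e * u) mod (2 * int N) + (2 * d' + e' * u) mod (2 * int N)) mod (2 * int N)
      = (2 * s + (e + e') * u) mod (2 * int N)"
      by (simp add: mod_add_eq cong_def algebra_simps)
    then show False
      using Z[OF that(1)] d that(2,3) unfolding A_def two_layers_def by blast
  qed
  have "Z \<subseteq> (\<lambda>s. (2 * s + u) mod (2 * int N)) ` C \<union> (\<lambda>s. 2 * s) ` {s \<in> C. (s - u) mod N \<in> C}"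
  proof
    fix n assume n: "n \<in> Z"
    show "n \<in> (\<lambda>s. (2 * s + u) mod (2 * int N)) ` C \<union> (\<lambda>s. 2 * s) ` {s \<in> C. (s - u) mod N \<in> C}"
    proof (cases "even n")
      case True
      then obtain s where s: "n = 2 * s" by blast
      have mods: "s mod N = s" "n mod (2 * int N) = n" using n s by (auto simp: Z_def)
      then have "s \<in> C" using not_sum[of s 0 0] n s by simp
      \<comment> \<open>Inside layer one, \<open>2 * s\<close> is read as
        \<open>2 * (s - u) + (1 + 1) * u\<close>.\<close>
      moreover have "(s - u) mod N \<in> C" using not_sum[of "s - u" 1 1] n s mods by simp
      ultimately show ?thesis using s by blast
    next
      case False
      then have "even (n - u)" using u by simp
      then obtain s where s: "n = 2 * s + u" by (metis dvdE diff_add_cancel)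
      have "n mod (2 * int N) = n" using n by (auto simp: Z_def)
      then have "s mod N \<in> C" using not_sum[of s 1 0] n s by simp
      moreover have "(2 * (s mod N) + u) mod (2 * int N) = n"
      proof -
        have "[2 * (s mod N) = 2 * s] (mod 2 * int N)" by (simp only: cong_double_iff) (simp add: cong_def)
        then have "[2 * (s mod N) + u = n] (mod 2 * int N)" unfolding s by (rule cong_add) simp
        then show ?thesis using \<open>n mod (2 * int N) = n\<close> by (simp add: cong_def)
      qed
      ultimately show ?thesis by blast
    qed
  qed
  then have "card Z \<le> card ((\<lambda>s. (2 * s + u) mod (2 * int N)) ` C \<union> (\<lambda>s. 2 * s) ` {s \<in> C. (s - u) mod N \<in> C})"
    by (rule card_mono[rotated]) (simp add: \<open>finite C\<close>)
  also have "\<dots> \<le> card ((\<lambda>s. (2 * s + u) mod (2 * int N)) ` C) + card ((\<lambda>s. 2 * s) ` {s \<in> C. (s - u) mod N \<in> C})"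
    by (rule card_Un_le)
  also have "\<dots> \<le> card C + card {s \<in> C. (s - u) mod N \<in> C}"
    by (intro add_mono card_image_le) (simp_all add: \<open>finite C\<close>)
  finally show ?thesis unfolding Z_def A_def .
qed

end

text \<open>The sumset has at least \<open>(q + 2) * (q + 1) / 2\<close> elements, which leaves at
  most \<open>q * (q - 1) / 2 < N / 2\<close> for \<open>C\<close>. The missed sums then number less
  than \<open>N / 2 + N / 4\<close>, which is \<open>3 / 8\<close> of \<open>2 * N\<close>.\<close>

lemma exists_two_layers_set:
  fixes N q :: nat and D :: "int set"
  assumes N: "N = q\<^sup>2 + q + 1" and sidon: "sidon_mod N D" and D: "finite D" "card D = q + 1"
  shows "\<exists>A \<subseteq> carrier (integer_mod_group (2 * N)).
    (\<forall>n. rep_count (integer_mod_group (2 * N)) A n \<le> 4) \<and>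
    real (card {n \<in> carrier (integer_mod_group (2 * N)). rep_count (integer_mod_group (2 * N)) A n = 0})
      < 3 / 8 * real (2 * N)"
proof -
  define C where "C = {0..<int N} - sumset_mod N D"
  have pos: "N > 0" using N by simp
  have "odd N" unfolding N by simp
  obtain v where v: "int N * int (card {s \<in> C. (s - v) mod N \<in> C}) \<le> int (card C) ^ 2"
    using exists_small_translate_intersection[of "int N" C] pos unfolding C_def by auto
  \<comment> \<open>The averaging ignores parity. As \<open>N\<close> is odd, adding it changes the
    parity of \<open>v\<close> but not its residue modulo \<open>N\<close>.\<close>
  define u where "u = (if odd v then v else v + N)"
  have u: "odd u" using \<open>odd N\<close> by (simp add: u_def)
  have "(s - u) mod N = (s - v) mod N" for s
    by (auto simp: u_def algebra_simps) (metis diff_diff_eq minus_mod_self2)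
  with v have inter: "real N * card {s \<in> C. (s - u) mod N \<in> C} \<le> real (card C) ^ 2"
    by (simp only: of_nat_le_iff flip: of_nat_mult of_nat_power)
  have sub: "sumset_mod N D \<subseteq> {0..<int N}" using pos by (auto simp: sumset_mod_def)
  have "2 * (Suc (card D) choose 2) = (q + 2) * (q + 1)"
    using D(2) by (simp add: choose_two)
  then have "card C + card (sumset_mod N D) = N" "(q + 2) * (q + 1) \<le> 2 * card (sumset_mod N D)"
    using card_sumset_sidon[OF D(1) sidon] card_mono[OF _ sub] sub
    by (auto simp: C_def card_Diff_subset finite_subset)
  then have "2 * card C < N"
    unfolding N by (simp add: power2_eq_square algebra_simps)
  then have C: "real (card C) < N / 2" by linarith
  then have "real (card C) ^ 2 < (N / 2) ^ 2" by (intro power_strict_mono) auto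
  then have "real N * card {s \<in> C. (s - u) mod N \<in> C} < real N * (real N / 4)"
    using inter by (simp add: power2_eq_square)
  then have "real (card {s \<in> C. (s - u) mod N \<in> C}) < N / 4"
    using pos by simp
  then have "real (card {n \<in> {0..<2 * int N}. rep_count (integer_mod_group (2 * N)) (two_layers N u D) n = 0})
    < 3 / 4 * real N"
    using C card_non_sums_two_layers_le[OF pos u D(1), folded C_def] by linarith
  then show ?thesis
    using two_layers_subset[OF pos u, of D] rep_count_two_layers_le[OF pos u sidon] pos
    by (intro exI[of _ "two_layers N u D"]) (auto simp: carrier_integer_mod_group)
qed

section \<open>Cubic extensions of finite fields\<close>

text \<open>If every monic cubic had a root, \<open>(r, b, c) \<mapsto> (X - r) (X\<^sup>2 + b X + c)\<close> would be surjective onto the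
  coefficient triples, hence injective by finiteness; but \<open>X (X\<^sup>2 - X) = (X - 1) X\<^sup>2\<close>.\<close>

lemma (in field) exists_rootless_cubic:
  assumes fin: "finite (carrier R)"
  shows "\<exists>a\<in>carrier R. \<exists>b\<in>carrier R. \<exists>c\<in>carrier R. \<forall>x\<in>carrier R.
    ((x \<oplus> a) \<otimes> x \<oplus> b) \<otimes> x \<oplus> c \<noteq> \<zero>"
proof (rule ccontr)
  assume neg: "\<not> ?thesis"
  define T where "T = carrier R \<times> carrier R \<times> carrier R"
  define \<Phi> where "\<Phi> = (\<lambda>(r, b, c). (b \<ominus> r, c \<ominus> r \<otimes> b, \<ominus> (r \<otimes> c)))"
  have "T \<subseteq> \<Phi> ` T"
  proof
    fix t assume "t \<in> T"
    then obtain a b c where t: "t = (a, b, c)" and mem: "a \<in> carrier R" "b \<in> carrier R" "c \<in> carrier R"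
      by (auto simp: T_def)
    then obtain x where x: "x \<in> carrier R" and root: "((x \<oplus> a) \<otimes> x \<oplus> b) \<otimes> x \<oplus> c = \<zero>"
      using neg by blast
    \<comment> \<open>Horner division by \<open>X - x\<close> leaves the quotient with coefficients
      \<open>\<one>\<close>, \<open>x \<oplus> a\<close>, \<open>?c\<close>; the remainder is the
      value at \<open>x\<close>, hence zero.\<close>
    let ?c = "(x \<oplus> a) \<otimes> x \<oplus> b"
    have "x \<otimes> ?c \<oplus> c = \<zero>"
      using root x mem by (simp add: m_comm)
    then have "c = \<ominus> (x \<otimes> ?c)"
      using minus_equality x mem by (metis a_closed m_closed minus_minus)
    moreover have "(x \<oplus> a) \<ominus> x = a"
      using x mem by algebra
    moreover have "?c \<ominus> x \<otimes> (x \<oplus> a) = b"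
      using x mem by algebra
    ultimately have "t = \<Phi> (x, x \<oplus> a, ?c)"
      by (simp add: \<Phi>_def t)
    moreover have "(x, x \<oplus> a, ?c) \<in> T"
      using x mem by (simp add: T_def)
    ultimately show "t \<in> \<Phi> ` T" by blast
  qed
  moreover have "finite T" using fin by (simp add: T_def)
  moreover have "\<Phi> ` T \<subseteq> T" by (auto simp: \<Phi>_def T_def)
  ultimately have "inj_on \<Phi> T"
    by (metis endo_inj_surj finite_surj_inj subset_antisym)
  moreover have "(\<zero>, \<ominus> \<one>, \<zero>) \<in> T" "(\<one>, \<zero>, \<zero>) \<in> T"
    by (auto simp: T_def)
  moreover have "\<Phi> (\<zero>, \<ominus> \<one>, \<zero>) = \<Phi> (\<one>, \<zero>, \<zero>)"
    by (simp add: \<Phi>_def minus_eq)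
  ultimately show False
    by (metis inj_onD prod.inject zero_not_one)
qed

text \<open>Factor degrees adding up to 3 are either 0 and 3 or 1 and 2. A linear factor would pass
  its root on to \<open>f\<close>, so one factor is a nonzero constant.\<close>

lemma (in field) rootless_cubic_pirreducible:
  assumes f: "f \<in> carrier (poly_ring R)" "degree f = 3"
    and rootless: "\<And>x. x \<in> carrier R \<Longrightarrow> eval f x \<noteq> \<zero>"
  shows "pirreducible (carrier R) f"
proof (rule pirreducibleI[OF carrier_is_subring f(1)])
  note units = univ_poly_units[OF carrier_is_subfield]
  show "f \<noteq> []" using f(2) by auto
  show "f \<notin> Units (poly_ring R)" using f(2) by (auto simp: units)
  fix q r assume q: "q \<in> carrier (poly_ring R)" and r: "r \<in> carrier (poly_ring R)"
    and fqr: "f = q \<otimes>\<^bsub>poly_ring R\<^esub> r"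
  have sets: "set q \<subseteq> carrier R" "set r \<subseteq> carrier R"
    using q r by (auto simp: polynomial_incl univ_poly_carrier[symmetric])
  have not_one: "degree s \<noteq> 1" if "s = q \<or> s = r" for s
  proof
    assume deg: "degree s = 1"
    let ?x = "\<ominus> (inv (lead_coeff s) \<otimes> const_term s)"
    have s: "s \<in> carrier (poly_ring R)" using that q r by auto
    have x: "?x \<in> carrier R" and root: "eval s ?x = \<zero>"
      using degree_one_root[OF carrier_is_subfield s deg] by auto
    have "eval f ?x = eval q ?x \<otimes> eval r ?x"
      using fqr eval_poly_mult[OF sets x] by (simp add: univ_poly_mult)
    then show False
      using that root rootless[OF x] eval_in_carrier[OF _ x] sets by auto
  qed
  have "degree f = (if q = [] \<or> r = [] then 0 else degree q + degree r)"
    using poly_mult_degree_eq[OF carrier_is_subring] q r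
    by (simp add: fqr univ_poly_mult univ_poly_carrier)
  with f(2) have "q \<noteq> []" "r \<noteq> []" "degree q + degree r = 3"
    by (auto split: if_splits)
  \<comment> \<open>The zero polynomial \<open>[]\<close> also has \<open>degree\<close> 0, so it is
    excluded separately.\<close>
  moreover have "s \<in> Units (poly_ring R)" if s: "s \<in> carrier (poly_ring R)" "s \<noteq> []" "degree s = 0" for s
  proof -
    obtain k where "s = [k]" using s(2,3) by (cases s) auto
    then show ?thesis using s(1)
      by (auto simp: units polynomial_def univ_poly_carrier[symmetric])
  qed
  moreover have "degree q = 0 \<or> degree r = 0"
  proof -
    have "degree q \<noteq> 1" "degree r \<noteq> 1" using not_one by blast+
    then show ?thesis using \<open>degree q + degree r = 3\<close> by linarith
  qed
  ultimately show "q \<in> Units (poly_ring R) \<or> r \<in> Units (poly_ring R)"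
    using q r by blast
qed

text \<open>Linear independence of 1, \<open>\<theta>\<close> and the square of
  \<open>\<theta>\<close> over \<open>K\<close>, with the combination in Horner form.\<close>

definition independent3 :: "('a, 'b) ring_scheme \<Rightarrow> 'a set \<Rightarrow> 'a \<Rightarrow> bool" where
  "independent3 L K \<theta> \<longleftrightarrow> (\<forall>a\<in>K. \<forall>b\<in>K. \<forall>c\<in>K.
    (a \<otimes>\<^bsub>L\<^esub> \<theta> \<oplus>\<^bsub>L\<^esub> b) \<otimes>\<^bsub>L\<^esub> \<theta> \<oplus>\<^bsub>L\<^esub> c = \<zero>\<^bsub>L\<^esub> \<longrightarrow> a = \<zero>\<^bsub>L\<^esub> \<and> b = \<zero>\<^bsub>L\<^esub> \<and> c = \<zero>\<^bsub>L\<^esub>)"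

text \<open>\<open>L\<close> is the quotient of the polynomial ring by an irreducible cubic and
  \<open>\<theta>\<close> is the class of \<open>X\<close>. Each class has a unique representative
  of degree at most 2; this gives both the size of \<open>L\<close> and the independence.\<close>

lemma (in field) exists_cubic_extension:
  assumes fin: "finite (carrier R)"
  shows "\<exists>(L :: 'a list set ring) K \<theta>. field L \<and> finite (carrier L) \<and> card (carrier L) = card (carrier R) ^ 3 \<and>
    subfield K L \<and> card K = card (carrier R) \<and> \<theta> \<in> carrier L \<and> independent3 L K \<theta>"
proof -
  obtain a b c where abc: "a \<in> carrier R" "b \<in> carrier R" "c \<in> carrier R"
    and rootless: "\<And>x. x \<in> carrier R \<Longrightarrow> ((x \<oplus> a) \<otimes> x \<oplus> b) \<otimes> x \<oplus> c \<noteq> \<zero>"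
    using exists_rootless_cubic[OF fin] by blast
  define f where "f = [\<one>, a, b, c]"
  define P where "P = poly_ring R"
  define L where "L = Rupt (carrier R) f"
  define \<pi> where "\<pi> = rupture_surj (carrier R) f"
  \<comment> \<open>The map \<open>h\<close> embeds the base field as constants; its image will be
    \<open>K\<close>.\<close>
  define h where "h = \<pi> \<circ> poly_of_const"
  define \<theta> where "\<theta> = \<pi> X"
  note subring = carrier_is_subring and subfield = carrier_is_subfield
  have f: "f \<in> carrier (poly_ring R)" "degree f = 3"
    using abc by (auto simp: f_def polynomial_def univ_poly_carrier[symmetric])
  have "eval f x \<noteq> \<zero>" if x: "x \<in> carrier R" for x
  proof -
    have "eval f x = ((x \<oplus> a) \<otimes> x \<oplus> b) \<otimes> x \<oplus> c"
      using x abc by (simp add: f_def numeral_2_eq_2 numeral_3_eq_3) algebra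
    then show ?thesis using rootless[OF x] by simp
  qed
  then have "pirreducible (carrier R) f"
    by (rule rootless_cubic_pirreducible[OF f])
  then interpret L: field L
    unfolding L_def using rupture_is_field_iff_pirreducible[OF subfield f(1)] by simp
  interpret P: domain P unfolding P_def by (rule univ_poly_is_domain[OF subring])
  interpret \<pi>: ring_hom_ring P L \<pi>
    unfolding P_def L_def \<pi>_def by (rule rupture_surj_hom(2)[OF subring f(1)])
  have "h \<in> ring_hom R L"
    using rupture_surj_norm_is_hom[OF subring f(1)] by (simp add: h_def \<pi>_def L_def)
  then interpret h: ring_hom_ring R L h
    by (intro ring_hom_ringI2 ring_axioms L.ring_axioms)
  define Q where "Q = {q \<in> carrier P. length q \<le> 3}"
  have Q: "(\<lambda>q. q pmod f) ` carrier P = Q"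
    using pmod_image_characterization[OF subfield f(1)] f by (auto simp: Q_def P_def f_def)
  have bij: "bij_betw \<pi> Q (carrier L)"
    using rupture_surj_inj_on[OF subfield f(1)] rupture_carrier_as_pmod_image[OF subfield f(1)] Q
    by (simp add: bij_betw_def \<pi>_def L_def P_def)
  define T where "T = carrier R \<times> carrier R \<times> carrier R"
  \<comment> \<open>Polynomials are lists without leading zeros, so a coefficient triple has to be
    normalized.\<close>
  define g where "g = (\<lambda>(a, b, c). normalize [a, b, c])"
  have g_closed: "g (u, v, w) \<in> carrier P" if "u \<in> carrier R" "v \<in> carrier R" "w \<in> carrier R" for u v w
    using that normalize_gives_polynomial[of "[u, v, w]"]
    by (simp add: g_def P_def univ_poly_carrier del: normalize.simps)
  have "bij_betw g T Q"
  proof (rule bij_betw_byWitness[where f' = "\<lambda>q. (coeff q 2, coeff q 1, coeff q 0)"])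
    show "\<forall>t\<in>T. (coeff (g t) 2, coeff (g t) 1, coeff (g t) 0) = t"
      by (auto simp: T_def g_def)
    show "\<forall>q\<in>Q. g (coeff q 2, coeff q 1, coeff q 0) = q"
    proof
      fix q assume "q \<in> Q"
      then have "polynomial (carrier R) q" "length q \<le> 3"
        by (auto simp: Q_def P_def univ_poly_carrier)
      then show "g (coeff q 2, coeff q 1, coeff q 0) = q"
        by (cases q rule: remdups_adj.cases; cases "tl (tl q)") (auto simp: g_def polynomial_def)
    qed
    show "g ` T \<subseteq> Q"
      using g_closed by (auto simp: T_def Q_def) (auto simp: g_def)
    show "(\<lambda>q. (coeff q 2, coeff q 1, coeff q 0)) ` Q \<subseteq> T"
      using coeff_in_carrier by (auto simp: T_def Q_def P_def polynomial_incl univ_poly_carrier[symmetric])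
  qed
  then have bij: "bij_betw (\<pi> \<circ> g) T (carrier L)"
    using bij by (rule bij_betw_trans)
  then have card: "card (carrier L) = card (carrier R) ^ 3"
    by (simp add: bij_betw_same_card[symmetric] T_def card_cartesian_product power3_eq_cube)
  have finL: "finite (carrier L)"
    using bij fin bij_betw_finite T_def by blast
  have \<theta>: "\<theta> \<in> carrier L"
    unfolding \<theta>_def using var_closed(1)[OF subring] by (simp add: P_def)
  \<comment> \<open>A polynomial is its own value at \<open>X\<close>; the homomorphism
    \<open>\<pi>\<close> carries this to a value at \<open>\<theta>\<close> with coefficients mapped
    by \<open>h\<close>.\<close>
  have \<pi>g: "\<pi> (g (u, v, w)) = (h u \<otimes>\<^bsub>L\<^esub> \<theta> \<oplus>\<^bsub>L\<^esub> h v) \<otimes>\<^bsub>L\<^esub> \<theta> \<oplus>\<^bsub>L\<^esub> h w"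
    if uvw: "u \<in> carrier R" "v \<in> carrier R" "w \<in> carrier R" for u v w
  proof -
    let ?q = "g (u, v, w)"
    have q: "?q \<in> carrier (poly_ring R)"
      using g_closed[OF uvw] by (simp add: P_def)
    have "\<pi> ?q = \<pi> (P.eval (map poly_of_const ?q) X)"
      using eval_rewrite[OF subring q] by (simp add: P_def)
    also have "\<dots> = L.eval (map \<pi> (map poly_of_const ?q)) (\<pi> X)"
      using \<pi>.eval_hom[OF P.carrier_is_subring var_closed(1)[OF subring, folded P_def]
          map_norm_in_poly_ring_carrier[OF subring q, folded P_def]] by simp
    also have "\<dots> = L.eval (map h ?q) \<theta>"
      by (simp add: h_def \<theta>_def)
    also have "\<dots> = (h u \<otimes>\<^bsub>L\<^esub> \<theta> \<oplus>\<^bsub>L\<^esub> h v) \<otimes>\<^bsub>L\<^esub> \<theta> \<oplus>\<^bsub>L\<^esub> h w"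
      using uvw \<theta> h.hom_closed
      by (auto simp: g_def numeral_2_eq_2 L.l_distr L.m_assoc L.a_assoc)
    finally show ?thesis .
  qed
  have "independent3 L (h ` carrier R) \<theta>"
    unfolding independent3_def
  proof (clarify)
    fix u v w assume uvw: "u \<in> carrier R" "v \<in> carrier R" "w \<in> carrier R"
      and "(h u \<otimes>\<^bsub>L\<^esub> \<theta> \<oplus>\<^bsub>L\<^esub> h v) \<otimes>\<^bsub>L\<^esub> \<theta> \<oplus>\<^bsub>L\<^esub> h w = \<zero>\<^bsub>L\<^esub>"
    then have "(\<pi> \<circ> g) (u, v, w) = (\<pi> \<circ> g) (\<zero>, \<zero>, \<zero>)"
      using \<pi>g[OF uvw] \<pi>g[of \<zero> \<zero> \<zero>] \<theta> by simp
    then have "(u, v, w) = (\<zero>, \<zero>, \<zero>)"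
      using bij uvw unfolding bij_betw_def T_def by (blast dest: inj_onD)
    then show "h u = \<zero>\<^bsub>L\<^esub> \<and> h v = \<zero>\<^bsub>L\<^esub> \<and> h w = \<zero>\<^bsub>L\<^esub>" by simp
  qed
  \<comment> \<open>A homomorphism from a field to a nonzero ring is injective, so the image has as
    many elements as \<open>R\<close>.\<close>
  moreover have "subfield (h ` carrier R) L" "inj_on h (carrier R)"
    using h.img_is_subfield[OF subfield] L.one_not_zero by auto
  ultimately show ?thesis
    using L.field_axioms finL card \<theta> card_image by blast
qed

section \<open>Singer's Sidon sets\<close>

text \<open>Homogeneous coordinates normalized to \<open>(0, 1)\<close> or \<open>(1, b)\<close>, so that proportional points are equal.\<close>

definition proj_line :: "('a, 'b) ring_scheme \<Rightarrow> 'a set \<Rightarrow> ('a \<times> 'a) set" where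
  "proj_line L K = insert (\<zero>\<^bsub>L\<^esub>, \<one>\<^bsub>L\<^esub>) (Pair \<one>\<^bsub>L\<^esub> ` K)"

lemma card_proj_line:
  assumes "finite K" "\<one>\<^bsub>L\<^esub> \<noteq> \<zero>\<^bsub>L\<^esub>"
  shows "card (proj_line L K) = Suc (card K)"
proof -
  have "card (Pair \<one>\<^bsub>L\<^esub> ` K) = card K" by (simp add: card_image inj_on_def)
  moreover have "(\<zero>\<^bsub>L\<^esub>, \<one>\<^bsub>L\<^esub>) \<notin> Pair \<one>\<^bsub>L\<^esub> ` K" using assms(2) by auto
  ultimately show ?thesis using assms(1) by (simp add: proj_line_def)
qed

text \<open>The hypothesis is proportionality by cross multiplication. Two points of the form
  \<open>(\<one>, b)\<close> then agree, and a mixed pair would give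
  \<open>\<one> = \<zero>\<close>.\<close>

lemma (in field) proj_line_proportional:
  assumes "K \<subseteq> carrier R" "(a, b) \<in> proj_line R K" "(c, d) \<in> proj_line R K" "c \<otimes> b = d \<otimes> a"
  shows "(a, b) = (c, d)"
  using assms by (auto simp: proj_line_def subset_iff)

section \<open>Products of linear expressions in \<open>\<theta>\<close>\<close>

context field
begin

context
  fixes K \<theta>
  assumes K: "subfield K R" and \<theta>: "\<theta> \<in> carrier R" and ind: "independent3 R K \<theta>"
begin

text \<open>On the normalized points this takes the values 1 and \<open>\<theta> \<oplus> b\<close>,
  the elements whose logarithms form Singer's set.\<close>

definition pencil :: "'a \<times> 'a \<Rightarrow> 'a" where
  "pencil = (\<lambda>(a, b). a \<otimes> \<theta> \<oplus> b)"

lemma proj_line_subset: "proj_line R K \<subseteq> K \<times> K"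
  using subringE(2,3)[OF subfieldE(1)[OF K]] by (auto simp: proj_line_def)

lemma independent_eqD:
  assumes "a \<in> K" "b \<in> K" "c \<in> K" "a' \<in> K" "b' \<in> K" "c' \<in> K"
    and eq: "(a \<otimes> \<theta> \<oplus> b) \<otimes> \<theta> \<oplus> c = (a' \<otimes> \<theta> \<oplus> b') \<otimes> \<theta> \<oplus> c'"
  shows "a = a' \<and> b = b' \<and> c = c'"
proof -
  note Kc = subsetD[OF subfieldE(3)[OF K]]
  note mem = assms(1-6)[THEN Kc] \<theta>
  have minus: "x \<ominus> y \<in> K" if "x \<in> K" "y \<in> K" for x y
    using that subringE(5,7)[OF subfieldE(1)[OF K]] by (simp add: minus_eq)
  have "((a \<ominus> a') \<otimes> \<theta> \<oplus> (b \<ominus> b')) \<otimes> \<theta> \<oplus> (c \<ominus> c')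
    = ((a \<otimes> \<theta> \<oplus> b) \<otimes> \<theta> \<oplus> c) \<ominus> ((a' \<otimes> \<theta> \<oplus> b') \<otimes> \<theta> \<oplus> c')"
    using mem by algebra
  also have "\<dots> = \<zero>" using mem by (simp add: eq)
  finally show ?thesis
    using ind minus assms(1-6) mem unfolding independent3_def by (metis r_right_minus_eq)
qed

lemma pencil_nonzero: "p \<in> proj_line R K \<Longrightarrow> pencil p \<in> carrier R - {\<zero>}"
proof -
  assume p: "p \<in> proj_line R K"
  obtain a b where ab: "p = (a, b)" by (cases p)
  have K': "a \<in> K" "b \<in> K" "\<zero> \<in> K" using p ab proj_line_subset subringE(2)[OF subfieldE(1)[OF K]] by auto
  note mem = K'[THEN subsetD[OF subfieldE(3)[OF K]]]
  have "a \<otimes> \<theta> \<oplus> b \<noteq> \<zero>"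
  proof
    assume "a \<otimes> \<theta> \<oplus> b = \<zero>"
    \<comment> \<open>A zero quadratic coefficient pads the linear relation to the shape that
      \<open>independent_eqD\<close> compares.\<close>
    then have "(\<zero> \<otimes> \<theta> \<oplus> a) \<otimes> \<theta> \<oplus> b = (\<zero> \<otimes> \<theta> \<oplus> \<zero>) \<otimes> \<theta> \<oplus> \<zero>"
      using mem \<theta> by simp
    from independent_eqD[OF _ _ _ _ _ _ this] have "a = \<zero>" "b = \<zero>" using K' by auto
    then show False using p ab by (auto simp: proj_line_def)
  qed
  then show ?thesis using mem \<theta> by (simp add: pencil_def ab)
qed

text \<open>Comparing coefficients gives \<open>a = k \<otimes> c\<close> and
  \<open>b = k \<otimes> d\<close>, so the coordinates are proportional, and normalization makes
  them equal.\<close>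

lemma pencil_proportional:
  assumes p: "p \<in> proj_line R K" and r: "r \<in> proj_line R K" and k: "k \<in> K"
    and eq: "pencil p = k \<otimes> pencil r"
  shows "p = r"
proof -
  obtain a b c d where ab: "p = (a, b)" and cd: "r = (c, d)" by (cases p, cases r)
  have K': "a \<in> K" "b \<in> K" "c \<in> K" "d \<in> K" "\<zero> \<in> K" "k \<otimes> c \<in> K" "k \<otimes> d \<in> K"
    using p r ab cd k proj_line_subset subringE(2,6)[OF subfieldE(1)[OF K]] by auto
  note mem = K'(1-4)[THEN subsetD[OF subfieldE(3)[OF K]]] subsetD[OF subfieldE(3)[OF K] k]
  have "k \<otimes> (c \<otimes> \<theta> \<oplus> d) = (k \<otimes> c) \<otimes> \<theta> \<oplus> k \<otimes> d" using mem \<theta> by algebra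
  then have "(\<zero> \<otimes> \<theta> \<oplus> a) \<otimes> \<theta> \<oplus> b = (\<zero> \<otimes> \<theta> \<oplus> k \<otimes> c) \<otimes> \<theta> \<oplus> k \<otimes> d"
    using mem \<theta> eq by (simp add: pencil_def ab cd)
  from independent_eqD[OF _ _ _ _ _ _ this] have "a = k \<otimes> c" "b = k \<otimes> d" using K' by auto
  then have "c \<otimes> b = d \<otimes> a" using mem by algebra
  then show ?thesis
    using proj_line_proportional[OF subfieldE(3)[OF K]] p r ab cd by blast
qed

text \<open>The multiplicative Sidon property, up to scalars of \<open>K\<close>. Independence makes
  two split quadratic forms over \<open>K\<close> agree; a zero of one is a zero of the other, which
  matches \<open>p\<close> with \<open>r\<close> or \<open>r'\<close>. Cancellation matches the
  other factors.\<close>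

lemma pencil_products:
  assumes P: "p \<in> proj_line R K" "p' \<in> proj_line R K" "r \<in> proj_line R K" "r' \<in> proj_line R K"
    and k: "k \<in> K"
    and eq: "pencil p \<otimes> pencil p' = k \<otimes> (pencil r \<otimes> pencil r')"
  shows "p = r \<and> p' = r' \<or> p = r' \<and> p' = r"
proof -
  have cancel: "p' = s'" if "s \<in> proj_line R K" "s' \<in> proj_line R K" "p = s"
    "pencil p \<otimes> pencil p' = k \<otimes> (pencil s \<otimes> pencil s')" for s s'
  proof -
    note mem = P(1,2)[THEN pencil_nonzero] that(2)[THEN pencil_nonzero] subsetD[OF subfieldE(3)[OF K] k]
    have "pencil p \<otimes> pencil p' = pencil p \<otimes> (k \<otimes> pencil s')"
      using that(3,4) mem by (simp add: m_lcomm)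
    then have "pencil p' = k \<otimes> pencil s'"
      using mem by (subst (asm) m_lcancel) auto
    then show ?thesis using pencil_proportional P(2) that(2) k by blast
  qed
  obtain a b a' b' c d c' d' where ab: "p = (a, b)" "p' = (a', b')" and cd: "r = (c, d)" "r' = (c', d')"
    by (cases p, cases p', cases r, cases r')
  have K': "a \<in> K" "b \<in> K" "a' \<in> K" "b' \<in> K" "c \<in> K" "d \<in> K" "c' \<in> K" "d' \<in> K"
    using P ab cd proj_line_subset by auto
  note mem = K'[THEN subsetD[OF subfieldE(3)[OF K]]] subsetD[OF subfieldE(3)[OF K] k]
  have closed: "x \<otimes> y \<in> K" "x \<oplus> y \<in> K" if "x \<in> K" "y \<in> K" for x y
    using that subringE(6,7)[OF subfieldE(1)[OF K]] by auto
  have "((a \<otimes> a') \<otimes> \<theta> \<oplus> (a \<otimes> b' \<oplus> a' \<otimes> b)) \<otimes> \<theta> \<oplus> b \<otimes> b' = pencil p \<otimes> pencil p'"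
    unfolding pencil_def ab using mem \<theta> by (simp, algebra)
  also have "\<dots> = ((k \<otimes> (c \<otimes> c')) \<otimes> \<theta> \<oplus> k \<otimes> (c \<otimes> d' \<oplus> c' \<otimes> d)) \<otimes> \<theta> \<oplus> k \<otimes> (d \<otimes> d')"
    unfolding eq unfolding pencil_def cd using mem \<theta> by (simp, algebra)
  finally have expanded: "((a \<otimes> a') \<otimes> \<theta> \<oplus> (a \<otimes> b' \<oplus> a' \<otimes> b)) \<otimes> \<theta> \<oplus> b \<otimes> b'
    = ((k \<otimes> (c \<otimes> c')) \<otimes> \<theta> \<oplus> k \<otimes> (c \<otimes> d' \<oplus> c' \<otimes> d)) \<otimes> \<theta> \<oplus> k \<otimes> (d \<otimes> d')" .
  have *: "a \<otimes> a' = k \<otimes> (c \<otimes> c') \<and> a \<otimes> b' \<oplus> a' \<otimes> b = k \<otimes> (c \<otimes> d' \<oplus> c' \<otimes> d)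
    \<and> b \<otimes> b' = k \<otimes> (d \<otimes> d')"
    by (rule independent_eqD[OF _ _ _ _ _ _ expanded]) (intro closed K' k)+
  note coeffs = *[THEN conjunct1] *[THEN conjunct2, THEN conjunct1] *[THEN conjunct2, THEN conjunct2]
  \<comment> \<open>Read \<open>coeffs\<close> as an equality of binary quadratic forms and evaluate at \<open>(a, b)\<close>, a zero of the left one.\<close>
  have "k \<otimes> ((c \<otimes> b \<ominus> d \<otimes> a) \<otimes> (c' \<otimes> b \<ominus> d' \<otimes> a))
    = (k \<otimes> (c \<otimes> c')) \<otimes> (b \<otimes> b) \<ominus> (k \<otimes> (c \<otimes> d' \<oplus> c' \<otimes> d)) \<otimes> (a \<otimes> b) \<oplus> (k \<otimes> (d \<otimes> d')) \<otimes> (a \<otimes> a)"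
    using mem by algebra
  also have "\<dots> = \<zero>"
    unfolding coeffs[symmetric] using mem by algebra
  finally have "k = \<zero> \<or> c \<otimes> b \<ominus> d \<otimes> a = \<zero> \<or> c' \<otimes> b \<ominus> d' \<otimes> a = \<zero>"
    using mem by (simp add: integral_iff)
  moreover have "k \<noteq> \<zero>"
    using eq P[THEN pencil_nonzero] by (auto simp: integral_iff)
  ultimately have "c \<otimes> b = d \<otimes> a \<or> c' \<otimes> b = d' \<otimes> a"
    using mem by simp
  then have "p = r \<or> p = r'"
    using proj_line_proportional[OF subfieldE(3)[OF K]] P ab cd by blast
  then show ?thesis
    using cancel P eq P[THEN pencil_nonzero] by (metis DiffD1 m_comm)
qed

end

section \<open>Discrete logarithms modulo \<open>N\<close>\<close>

text \<open>With \<open>n = card K - 1\<close>, the generator has order \<open>n * N\<close>. A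
  nonzero \<open>k = g [^] i\<close> in \<open>K\<close> has \<open>n\<close>-th power one, so
  \<open>N\<close> divides \<open>i\<close>.\<close>

lemma primitive_power_in_subfield:
  assumes fin: "finite (carrier R)" and K: "subfield K R"
    and g: "g \<in> carrier R - {\<zero>}" "carrier R - {\<zero>} = {g [^] i | i :: nat. i \<in> UNIV}"
    and N: "card (carrier R) - 1 = (card K - 1) * N"
  shows "g [^] (N * t) \<in> K - {\<zero>}"
proof -
  let ?G = "Multiplicative_Group.mult_of R" and ?GK = "Multiplicative_Group.mult_of (R\<lparr>carrier := K\<rparr>)"
  interpret G: group ?G rewrites
      "([^]\<^bsub>?G\<^esub>) = (([^]) :: _ \<Rightarrow> nat \<Rightarrow> _)" and "\<one>\<^bsub>?G\<^esub> = \<one>" and "monoid.mult ?G = (\<otimes>)"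
    by (rule field_mult_group) (simp_all add: Multiplicative_Group.nat_pow_mult_of)
  interpret K: field "R\<lparr>carrier := K\<rparr>" by (rule subfield_iff(2)[OF K])
  have finK: "finite K" using fin subfieldE(3)[OF K] finite_subset by blast
  have zero: "\<zero> \<in> K" "\<one> \<in> K" "\<one> \<noteq> \<zero>" using K.zero_closed K.one_closed K.one_not_zero by auto
  then have card_K: "card K \<ge> 2"
    using card_mono[OF finK, of "{\<zero>, \<one>}"] by auto
  define n where "n = card K - 1"
  have n: "n > 0" using card_K by (simp add: n_def)
  have g': "g \<in> carrier ?G" and fin': "finite (carrier ?G)" using g(1) fin by simp_all
  have "carrier ?G = ([^]) g ` {0..G.ord g - 1}"
    using G.ord_elems[OF fin' g'] g(2) by auto
  then have "card (carrier ?G) = G.ord g"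
    using G.ord_inj[OF g'] G.ord_ge_1[OF fin' g'] by (simp add: card_image)
  then have ord: "G.ord g = n * N"
    using N by (simp add: card_Diff_singleton n_def)
  have one_iff: "g [^] (i :: nat) = \<one> \<longleftrightarrow> n * N dvd i" for i
    using G.pow_eq_id[OF g'] ord by simp
  have period: "g [^] (N * t) = g [^] (N * (t mod n))" for t
  proof -
    have "N * t = n * N * (t div n) + N * (t mod n)"
      by (metis add_mult_distrib2 mult.commute mult.left_commute mult_div_mod_eq)
    then have "g [^] (N * t) = g [^] (n * N * (t div n)) \<otimes> g [^] (N * (t mod n))"
      using g(1) by (simp add: nat_pow_mult)
    also have "g [^] (n * N * (t div n)) = \<one>" by (simp add: one_iff)
    finally show ?thesis using g(1) by simp
  qed
  have "K - {\<zero>} \<subseteq> (\<lambda>s. g [^] (N * s)) ` {..<n}"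
  proof
    fix k assume k: "k \<in> K - {\<zero>}"
    then have "k \<in> {g [^] i | i :: nat. i \<in> UNIV}"
      unfolding g(2)[symmetric] using subfieldE(3)[OF K] by auto
    then obtain i :: nat where i: "k = g [^] i" by blast
    have "k [^]\<^bsub>?GK\<^esub> order ?GK = \<one>\<^bsub>?GK\<^esub>"
      using k finK by (intro group.pow_order_eq_1 K.field_mult_group) auto
    then have "k [^] n = \<one>"
      using finK zero by (simp add: Multiplicative_Group.nat_pow_mult_of order_def n_def card_Diff_singleton nat_pow_consistent[symmetric])
    then have "g [^] (i * n) = \<one>" using g(1) by (simp add: i nat_pow_pow)
    then have "N dvd i" using n by (simp add: one_iff mult.commute)
    then obtain t where "i = N * t" by blast
    then show "k \<in> (\<lambda>s. g [^] (N * s)) ` {..<n}"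
      using period[of t] n i by auto
  qed
  \<comment> \<open>There are at most \<open>n\<close> such powers and exactly \<open>n\<close>
    nonzero elements of \<open>K\<close>, so the inclusion is an equality.\<close>
  moreover have "card ((\<lambda>s. g [^] (N * s)) ` {..<n}) \<le> card (K - {\<zero>})"
    using card_image_le[of "{..<n}"] finK zero by (simp add: n_def card_Diff_singleton)
  ultimately have "(\<lambda>s. g [^] (N * s)) ` {..<n} = K - {\<zero>}"
    by (metis card_seteq finite_imageI finite_lessThan)
  moreover have "g [^] (N * t) \<in> (\<lambda>s. g [^] (N * s)) ` {..<n}"
    using period[of t] n by (intro image_eqI[of _ _ "t mod n"]) auto
  ultimately show ?thesis by blast
qed

text \<open>Exponents congruent modulo \<open>N\<close> belong to elements that differ by a factor
  in \<open>K\<close>. Congruent sums of logarithms thus become products equal up to such a factor,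
  to which \<open>pencil_products\<close> applies.\<close>

lemma exists_singer_sidon_set:
  assumes fin: "finite (carrier R)" and K: "subfield K R" and card: "card (carrier R) = card K ^ 3"
    and \<theta>: "\<theta> \<in> carrier R" and ind: "independent3 R K \<theta>"
  shows "\<exists>D. finite D \<and> card D = card K + 1 \<and> sidon_mod (int ((card K)\<^sup>2 + card K + 1)) D"
proof -
  define q where "q = card K"
  define N where "N = q\<^sup>2 + q + 1"
  define P where "P = proj_line R K"
  define pt where "pt = pencil \<theta>"
  note prods = pencil_products[OF K \<theta> ind, folded P_def pt_def]
  have finK: "finite K" using fin subfieldE(3)[OF K] finite_subset by blast
  have one: "\<one> \<in> K" "\<one> \<noteq> \<zero>" using subringE(3)[OF subfieldE(1)[OF K]] by auto
  then have "q > 0" using finK by (auto simp: q_def card_gt_0_iff)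
  then have "q ^ 3 - 1 = (q - 1) * N"
    by (simp add: N_def diff_mult_distrib add_mult_distrib2 power2_eq_square power3_eq_cube)
  then have N: "card (carrier R) - 1 = (card K - 1) * N" by (simp add: card q_def)
  obtain g where g: "g \<in> carrier R - {\<zero>}" "carrier R - {\<zero>} = {g [^] i | i :: nat. i \<in> UNIV}"
    using finite_field_mult_group_has_gen[OF fin]
    unfolding Multiplicative_Group.carrier_mult_of by blast
  note power_in = primitive_power_in_subfield[OF fin K g N]
  have gc: "g \<in> carrier R" using g(1) by simp
  \<comment> \<open>Any exponent may be chosen: those of one nonzero element differ by multiples of
    \<open>q ^ 3 - 1\<close>, hence of \<open>N\<close>.\<close>
  define lg where "lg x = (SOME i :: nat. g [^] i = x)" for x
  have lg: "g [^] lg x = x" if "x \<in> carrier R - {\<zero>}" for x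
  proof -
    have "x \<in> {g [^] i | i :: nat. i \<in> UNIV}"
      unfolding g(2)[symmetric] using that by simp
    then have "\<exists>i :: nat. g [^] i = x" by blast
    then show ?thesis unfolding lg_def by (rule someI_ex)
  qed
  have pt: "pt p \<in> carrier R - {\<zero>}" if "p \<in> P" for p
    using that pencil_nonzero[OF K \<theta> ind] by (simp add: P_def pt_def)
  have ratio: "\<exists>k\<in>K. g [^] i = k \<otimes> g [^] j" if ij: "[i = j] (mod N)" "j \<le> i" for i j :: nat
  proof -
    have "N dvd i - j" using ij by (simp add: cong_altdef_nat)
    then obtain t where "i - j = N * t" by blast
    then have "i = N * t + j" using ij(2) by linarith
    then have "g [^] i = g [^] (N * t) \<otimes> g [^] j" using gc by (simp add: nat_pow_mult)
    then show ?thesis using power_in[of t] by blast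
  qed
  \<comment> \<open>Exponents are natural numbers, so the larger sum stands on the left to make the
    quotient a power of \<open>g\<close>; symmetry supplies the other case.\<close>
  have sidon: "p = r \<and> p' = r' \<or> p = r' \<and> p' = r"
    if mem: "p \<in> P" "p' \<in> P" "r \<in> P" "r' \<in> P"
      and cong: "[lg (pt p) + lg (pt p') = lg (pt r) + lg (pt r')] (mod N)"
      and le: "lg (pt r) + lg (pt r') \<le> lg (pt p) + lg (pt p')" for p p' r r'
  proof -
    have "g [^] (lg (pt s) + lg (pt s')) = pt s \<otimes> pt s'" if "s \<in> P" "s' \<in> P" for s s'
      using that pt lg gc by (simp flip: nat_pow_mult)
    then obtain k where "k \<in> K" "pt p \<otimes> pt p' = k \<otimes> (pt r \<otimes> pt r')"
      using ratio[OF cong le] mem by metis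
    then show ?thesis using prods mem by blast
  qed
  define f where "f p = int (lg (pt p))" for p
  \<comment> \<open>Equal logarithms give equal sums, so injectivity is an instance of
    \<open>sidon\<close>.\<close>
  have inj: "inj_on f P"
    by (rule inj_onI) (use sidon in \<open>fastforce simp: f_def\<close>)
  have "sidon_mod (int N) (f ` P)"
    unfolding sidon_mod_def
  proof (intro ballI impI)
    fix w x y z assume "w \<in> f ` P" "x \<in> f ` P" "y \<in> f ` P" "z \<in> f ` P"
      and "[w + x = y + z] (mod int N)"
    then obtain p p' r r' where mem: "p \<in> P" "p' \<in> P" "r \<in> P" "r' \<in> P"
      and eqs: "w = f p" "x = f p'" "y = f r" "z = f r'"
      and "[int (lg (pt p) + lg (pt p')) = int (lg (pt r) + lg (pt r'))] (mod int N)"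
      by (auto simp: f_def)
    then have "[lg (pt p) + lg (pt p') = lg (pt r) + lg (pt r')] (mod N)"
      by (simp only: cong_int_iff)
    then have "p = r \<and> p' = r' \<or> p = r' \<and> p' = r"
      using sidon[OF mem] sidon[OF mem(3,4,1,2)] by (metis cong_sym nat_le_linear)
    then show "{w, x} = {y, z}" using eqs by auto
  qed
  moreover have "finite P" using finK by (simp add: P_def proj_line_def)
  moreover have "card P = card K + 1"
    using card_proj_line[OF finK one(2)] by (simp add: P_def)
  ultimately show ?thesis
    using card_image[OF inj] unfolding N_def q_def by (metis finite_imageI)
qed

end

theorem theorem1p1:
  fixes p m :: nat
  assumes "Factorial_Ring.prime p"
    and "m = 2 * (p\<^sup>2 + p + 1)"
  shows "\<exists>A \<subseteq> carrier (integer_mod_group m).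
    (\<forall>n \<in> carrier (integer_mod_group m). rep_count (integer_mod_group m) A n \<le> 5) \<and>
    real (card {n \<in> carrier (integer_mod_group m). rep_count (integer_mod_group m) A n = 0})
      < 3 / 8 * real m"
proof -
  \<comment> \<open>The base field is the prime field with \<open>p\<close> elements, so that
    \<open>card K = p\<close> and the modulus of the Sidon set is
    \<open>p^2 + p + 1\<close>.\<close>
  interpret residues_prime p "residue_ring (int p)"
    by (unfold_locales) (use assms(1) in auto)
  have card_R: "card (carrier (residue_ring (int p))) = p" "finite (carrier (residue_ring (int p)))"
    by (simp_all add: res_carrier_eq)
  obtain L :: "int list set ring" and K \<theta> where L: "field L" "finite (carrier L)" "card (carrier L) = card K ^ 3"
    "subfield K L" "card K = p" "\<theta> \<in> carrier L" "independent3 L K \<theta>"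
    using exists_cubic_extension card_R by metis
  obtain D where D: "finite D" "card D = p + 1" "sidon_mod (int (p\<^sup>2 + p + 1)) D"
    using field.exists_singer_sidon_set[OF L(1,2,4,3,6,7)] L(5) by auto
  obtain A where "A \<subseteq> carrier (integer_mod_group m)" "\<And>n. rep_count (integer_mod_group m) A n \<le> 4"
    "real (card {n \<in> carrier (integer_mod_group m). rep_count (integer_mod_group m) A n = 0}) < 3 / 8 * real m"
    using exists_two_layers_set[OF refl D(3,1,2)] unfolding assms(2) by blast
  then show ?thesis
    by (intro exI[of _ A] conjI ballI) (auto intro: order.trans[of _ 4])
qed

end
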